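(* The sequence $(P(n))_{n=1}^\infty$ of Catalan-Larcombe-French numbers, given by $$P(n)=2^n\sum_{k=0}^n \binom{n}{2k}\binom{2k}{k}^2 4^{n-2k},$$ is realizable.
   Context: A sequence $a=(a(n))_{n=1}^\infty$ of non-negative integers is called realizable if one of the following two equivalent conditions holds: (1) there is a self-map $T:X\to X$ on a set $X$ such that $a(n)=\#\{x\in X: T^n(x)=x\}$ for all $n\ge 1$; (2) for all $n\ge 1$, $(\mu*a)(n)=\sum_{d\mid n}\mu(n/d)\,a(d)$ is a non-negative integer divisible by $n$, where $\mu$ is the classical Möbius function and $*$ is Dirichlet convolution. Binomial coefficients $\binom{n}{2k}$ with $2k>n$ are $0$, so the terms of the sum with $2k>n$ vanish. *)

theory Defs
  imports
    "HOL-Computational_Algebra.Computational_Algebra"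
    "HOL-Number_Theory.Cong"
    "HOL-Library.FuncSet"
    "HOL-Library.Nat_Bijection"
begin

definition moebius_mu :: "nat \<Rightarrow> int" where
  "moebius_mu n = (if squarefree n then (-1) ^ card (prime_factors n) else 0)"

definition dirichlet_conv :: "(nat \<Rightarrow> int) \<Rightarrow> (nat \<Rightarrow> int) \<Rightarrow> nat \<Rightarrow> int" where
  "dirichlet_conv f g n = (\<Sum>d | d dvd n. f (n div d) * g d)"

lemma moebius_mu_prime_mult:
  assumes "prime p" "\<not> p dvd d"
  shows "moebius_mu (p * d) = - moebius_mu d"
proof (cases "squarefree d")
  case True
  have d0: "d \<noteq> 0" using assms by (intro notI) auto
  have cop: "coprime p d" using assms by (simp add: prime_imp_coprime)
  have sq: "squarefree (p * d)"
    using True cop assms(1) by (simp add: squarefree_mult_coprime squarefree_prime)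
  have "prime_factors (p * d) = insert p (prime_factors d)"
    using assms(1) d0 by (subst prime_factors_product) (auto simp: prime_prime_factors)
  moreover have "p \<notin> prime_factors d" using assms by auto
  ultimately show ?thesis using sq True by (simp add: moebius_mu_def)
next
  case False
  then have "\<not> squarefree (p * d)"
    using squarefree_multD(2) by blast
  with False show ?thesis by (simp add: moebius_mu_def)
qed

lemma sum_moebius_mu:
  assumes "n > 0"
  shows "(\<Sum>d | d dvd n. moebius_mu d) = (if n = 1 then 1 else 0)"
proof (cases "n = 1")
  case True
  then show ?thesis by (simp add: moebius_mu_def)
next
  case False
  then obtain p where p: "prime p" "p dvd n" using prime_factor_nat by blast
  let ?A = "{d. d dvd n \<and> \<not> p dvd d \<and> squarefree d}"
  let ?B = "{d. d dvd n \<and> p dvd d \<and> squarefree d}"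
  have fin: "finite {d. d dvd n}" using assms by simp
  have finA: "finite ?A" and finB: "finite ?B" using fin by (auto intro: finite_subset)
  have "(\<Sum>d | d dvd n. moebius_mu d) = sum moebius_mu (?A \<union> ?B)"
    by (rule sum.mono_neutral_right[OF fin]) (auto simp: moebius_mu_def)
  also have "\<dots> = sum moebius_mu ?A + sum moebius_mu ?B"
    by (rule sum.union_disjoint[OF finA finB]) auto
  also have "sum moebius_mu ?B = (\<Sum>d\<in>?A. moebius_mu (p * d))"
  proof (rule sum.reindex_bij_witness[of _ "\<lambda>d. p * d" "\<lambda>d. d div p"])
    fix a assume a: "a \<in> ?B"
    then obtain b where b: "a = p * b" by auto
    have p0: "p > 0" using p(1) prime_gt_0_nat by blast
    have nb: "\<not> p dvd b"
    proof
      assume "p dvd b"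
      then have "p ^ 2 dvd a" using b by (auto simp: power2_eq_square)
      with a have "is_unit p" by (auto simp: squarefree_def)
      with p(1) show False by simp
    qed
    show "p * (a div p) = a" using b p0 by simp
    show "a div p \<in> ?A" using a b nb p0
      by (auto dest: squarefree_multD dvd_mult_right)
    show "moebius_mu (p * (a div p)) = moebius_mu a" using b p0 by simp
  next
    fix a assume a: "a \<in> ?A"
    have p0: "p > 0" using p(1) prime_gt_0_nat by blast
    show "p * a div p = a" using p0 by simp
    have cop: "coprime p a" using a p(1) by (simp add: prime_imp_coprime)
    then show "p * a \<in> ?B" using a p
      by (auto intro: divides_mult simp: squarefree_mult_coprime squarefree_prime)
  qed
  also have "\<dots> = (\<Sum>d\<in>?A. - moebius_mu d)"
    by (rule sum.cong) (auto simp: moebius_mu_prime_mult[OF p(1)])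
  finally show ?thesis using False by (simp add: sum_negf)
qed

lemma sum_divisors_swap:
  fixes h :: "nat \<Rightarrow> nat \<Rightarrow> int"
  assumes "n > 0"
  shows "(\<Sum>d | d dvd n. \<Sum>e | e dvd d. h d e) = (\<Sum>e | e dvd n. \<Sum>c | c dvd n div e. h (e * c) e)"
proof -
  have fin: "finite {d. d dvd n}" using assms by simp
  have finite_div: "finite {e. e dvd d}" if "d dvd n" for d :: nat
    using that assms by (auto intro!: finite_divisors_nat intro: Nat.gr0I)
  have "(\<Sum>d | d dvd n. \<Sum>e | e dvd d. h d e)
      = (\<Sum>(d, e) \<in> Sigma {d. d dvd n} (\<lambda>d. {e. e dvd d}). h d e)"
    by (rule sum.Sigma) (use fin finite_div in auto)
  also have "\<dots> = (\<Sum>(e, c) \<in> Sigma {e. e dvd n} (\<lambda>e. {c. c dvd n div e}). h (e * c) e)"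
  proof (rule sum.reindex_bij_witness[of _ "\<lambda>(e, c). (e * c, e)" "\<lambda>(d, e). (e, d div e)"], goal_cases)
    case (1 a)
    then obtain d e where [simp]: "a = (d, e)" and "d dvd n" "e dvd d" by auto
    then show ?case by auto
  next
    case (2 a)
    then obtain d e where a[simp]: "a = (d, e)" and "d dvd n" "e dvd d" by auto
    then show ?case by (auto intro: div_dvd_div[THEN iffD2] dvd_trans)
  next
    case (3 b)
    then obtain e c where b[simp]: "b = (e, c)" and *: "e dvd n" "c dvd n div e" by auto
    then have "e \<noteq> 0" using assms by (intro notI) auto
    then show ?case by simp
  next
    case (4 b)
    then obtain e c where b[simp]: "b = (e, c)" and *: "e dvd n" "c dvd n div e" by auto
    then have "e * c dvd n" by (metis dvd_div_mult_self dvd_refl mult.commute mult_dvd_mono)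
    then show ?case by simp
  next
    case (5 a)
    then show ?case by auto
  qed
  also have "\<dots> = (\<Sum>e | e dvd n. \<Sum>c | c dvd n div e. h (e * c) e)"
  proof (rule sum.Sigma[symmetric])
    show "\<forall>e\<in>{e. e dvd n}. finite {c. c dvd n div e}"
      by (auto intro!: finite_div)
  qed (use fin in auto)
  finally show ?thesis .
qed

lemma sum_moebius_mu_div:
  fixes n e :: nat
  assumes "n > 0" "e dvd n"
  shows "(\<Sum>c | c dvd n div e. moebius_mu c) = (if e = n then 1 else 0)"
    and "(\<Sum>c | c dvd n div e. moebius_mu (n div (e * c))) = (if e = n then 1 else 0)"
proof -
  obtain k where k: "n = e * k" using assms by auto
  then have e0: "e > 0" "k > 0" using assms by auto
  have nk: "n div e = k" using k e0 by simp
  have ek: "e = n \<longleftrightarrow> k = 1" using k e0 by auto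
  show 1: "(\<Sum>c | c dvd n div e. moebius_mu c) = (if e = n then 1 else 0)"
    using sum_moebius_mu[OF e0(2)] nk ek by simp
  have "(\<Sum>c | c dvd n div e. moebius_mu (n div (e * c))) = (\<Sum>c | c dvd k. moebius_mu (k div c))"
    unfolding nk by (rule sum.cong) (use k e0 in auto)
  also have "\<dots> = (\<Sum>c | c dvd k. moebius_mu c)"
    by (rule sum.reindex_bij_witness[of _ "\<lambda>c. k div c" "\<lambda>c. k div c"])
       (use e0 in \<open>auto elim!: dvdE\<close>)
  finally show "(\<Sum>c | c dvd n div e. moebius_mu (n div (e * c))) = (if e = n then 1 else 0)"
    using 1 nk by simp
qed

lemma moebius_inversion:
  assumes "\<And>m. m > 0 \<Longrightarrow> g m = (\<Sum>d | d dvd m. f d)" and n: "n > 0"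
  shows "dirichlet_conv moebius_mu g n = f n"
proof -
  have "dirichlet_conv moebius_mu g n = (\<Sum>d | d dvd n. \<Sum>e | e dvd d. moebius_mu (n div d) * f e)"
    unfolding dirichlet_conv_def
    by (rule sum.cong) (use n assms(1) in \<open>auto simp: sum_distrib_left dvd_pos_nat\<close>)
  also have "\<dots> = (\<Sum>e | e dvd n. (\<Sum>c | c dvd n div e. moebius_mu (n div (e * c))) * f e)"
    by (simp add: sum_divisors_swap[OF n] sum_distrib_right)
  also have "\<dots> = (\<Sum>e | e dvd n. if e = n then f e else 0)"
    by (rule sum.cong) (use sum_moebius_mu_div(2)[OF n] in auto)
  also have "\<dots> = f n" using n by (simp add: sum.delta)
  finally show ?thesis .
qed

lemma sum_dirichlet_conv_moebius_mu:
  assumes n: "n > 0"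
  shows "(\<Sum>d | d dvd n. dirichlet_conv moebius_mu g d) = g n"
proof -
  have "(\<Sum>d | d dvd n. dirichlet_conv moebius_mu g d)
      = (\<Sum>e | e dvd n. \<Sum>c | c dvd n div e. moebius_mu (e * c div e) * g e)"
    unfolding dirichlet_conv_def by (rule sum_divisors_swap[OF n])
  also have "\<dots> = (\<Sum>e | e dvd n. (\<Sum>c | c dvd n div e. moebius_mu c) * g e)"
    unfolding sum_distrib_right
    by (intro sum.cong refl) (use n in \<open>auto simp: dvd_pos_nat\<close>)
  also have "\<dots> = (\<Sum>e | e dvd n. if e = n then g e else 0)"
    by (rule sum.cong) (use sum_moebius_mu_div(1)[OF n] in auto)
  also have "\<dots> = g n" using n by (simp add: sum.delta)
  finally show ?thesis .
qed

text \<open>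
  Sequences start at index 1: the value \<open>a 0\<close> is irrelevant below.  Finiteness is
  required explicitly because \<open>card\<close> of an infinite set is 0.
\<close>

definition realized_by :: "(nat \<Rightarrow> nat) \<Rightarrow> 'a set \<Rightarrow> ('a \<Rightarrow> 'a) \<Rightarrow> bool" where
  "realized_by a X T \<longleftrightarrow> T \<in> X \<rightarrow> X \<and>
     (\<forall>n\<ge>1. finite {x \<in> X. (T ^^ n) x = x} \<and> card {x \<in> X. (T ^^ n) x = x} = a n)"

text \<open>
  One cannot quantify existentially over types, so the set \<open>X\<close> is taken to be a
  set of natural numbers.  This loses nothing: \<open>realized_by_imp_realizable\<close> below
  covers carriers in an arbitrary type.
\<close>

definition realizable :: "(nat \<Rightarrow> nat) \<Rightarrow> bool" where
  "realizable a \<longleftrightarrow> (\<exists>(X :: nat set) T. realized_by a X T)"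

definition moebius_condition :: "(nat \<Rightarrow> nat) \<Rightarrow> bool" where
  "moebius_condition a \<longleftrightarrow>
     (\<forall>n\<ge>1. dirichlet_conv moebius_mu (\<lambda>d. int (a d)) n \<ge> 0 \<and>
            int n dvd dirichlet_conv moebius_mu (\<lambda>d. int (a d)) n)"

lemma realized_by_imp_moebius_condition:
  fixes X :: "'a set"
  assumes "realized_by a X T"
  shows "moebius_condition a"
proof -
  define F where "F = (\<lambda>n. {x \<in> X. (T ^^ n) x = x})"
  define L where "L = (\<lambda>n. {x \<in> F n. \<forall>m. 0 < m \<longrightarrow> m < n \<longrightarrow> (T ^^ m) x \<noteq> x})"
  have TX: "T x \<in> X" if "x \<in> X" for x using assms that by (auto simp: realized_by_def)
  have TkX: "(T ^^ k) x \<in> X" if "x \<in> X" for k x using that by (induction k) (auto simp: TX)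
  have finF: "finite (F n)" and cardF: "card (F n) = a n" if "n > 0" for n
    using assms that by (auto simp: realized_by_def F_def Suc_le_eq)
  have finL: "finite (L n)" if "n > 0" for n using finF[OF that] by (auto simp: L_def)
  have period: "(T ^^ m) x = x \<longleftrightarrow> n dvd m" if "x \<in> L n" "n > 0" for x n m
  proof
    assume m: "(T ^^ m) x = x"
    have "(T ^^ (m mod n)) x = x"
      using that m funpow_mod_eq[of n T x m] by (simp add: L_def F_def)
    moreover have "m mod n < n" using that by simp
    ultimately have "m mod n = 0" using that by (auto simp: L_def)
    then show "n dvd m" by auto
  next
    assume "n dvd m"
    then show "(T ^^ m) x = x"
      using that funpow_mod_eq[of n T x m] by (auto simp: L_def F_def)
  qed
  have F_eq: "F n = (\<Union>d\<in>{d. d dvd n}. L d)" if n: "n > 0" for n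
  proof (intro equalityI subsetI)
    fix x assume x: "x \<in> F n"
    define d where "d = (LEAST k. 0 < k \<and> (T ^^ k) x = x)"
    have ex: "0 < n \<and> (T ^^ n) x = x" using x n by (auto simp: F_def)
    have d: "0 < d \<and> (T ^^ d) x = x" unfolding d_def by (rule LeastI, rule ex)
    have min: "\<not> (0 < m \<and> (T ^^ m) x = x)" if "m < d" for m
      using not_less_Least that unfolding d_def by blast
    have xL: "x \<in> L d" using x d min by (auto simp: L_def F_def)
    moreover have "d dvd n" using period[OF xL] d ex by auto
    ultimately show "x \<in> (\<Union>d\<in>{d. d dvd n}. L d)" by auto
  next
    fix x assume "x \<in> (\<Union>d\<in>{d. d dvd n}. L d)"
    then obtain d where d: "d dvd n" "x \<in> L d" by auto
    then have "d > 0" using n by (auto intro: Nat.gr0I)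
    then have "(T ^^ n) x = x" using period d by auto
    then show "x \<in> F n" using d by (auto simp: F_def L_def)
  qed
  have disj: "L d \<inter> L e = {}" if "d > 0" "e > 0" "d \<noteq> e" for d e
  proof (rule ccontr)
    assume "L d \<inter> L e \<noteq> {}"
    then obtain x where "x \<in> L d" "x \<in> L e" by auto
    then have "d dvd e" "e dvd d"
      using period[of x d e] period[of x e e] period[of x d d] period[of x e d] that(1,2) by simp_all
    then show False using that(3) dvd_antisym[of d e] by simp
  qed
  have sum: "int (a n) = (\<Sum>d | d dvd n. int (card (L d)))" if n: "n > 0" for n
  proof -
    have "card (F n) = (\<Sum>d | d dvd n. card (L d))"
      unfolding F_eq[OF n]
      by (rule card_UN_disjoint)
         (use n finL disj in \<open>auto simp: dvd_pos_nat\<close>)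
    then show ?thesis using cardF[OF n] by simp
  qed
  have dvd: "n dvd card (L n)" if n: "n > 0" for n
  proof -
    define orb where "orb = (\<lambda>x. (\<lambda>k. (T ^^ k) x) ` {..<n})"
    have fix_pt: "(T ^^ n) x = x" if "x \<in> L n" for x using that by (auto simp: L_def F_def)
    have orb_all: "(T ^^ k) x \<in> orb x" if "x \<in> L n" for x k
    proof -
      have "(T ^^ k) x = (T ^^ (k mod n)) x" using funpow_mod_eq[OF fix_pt[OF that]] by simp
      then show ?thesis using n unfolding orb_def by auto
    qed
    have returns: "\<exists>j. (T ^^ j) ((T ^^ k) x) = x" if "x \<in> L n" for x k
    proof -
      have "(T ^^ (n * k - k)) ((T ^^ k) x) = (T ^^ (n * k)) x"
        using n by (simp flip: funpow_add[THEN fun_cong, unfolded o_apply])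
      also have "\<dots> = x" using period[OF that n] by simp
      finally show ?thesis by blast
    qed
    have inL: "(T ^^ k) x \<in> L n" if x: "x \<in> L n" for x k
    proof -
      have comm: "(T ^^ m) ((T ^^ k) x) = (T ^^ k) ((T ^^ m) x)" for m k x
        by (metis add.commute comp_apply funpow_add)
      obtain j where j: "(T ^^ j) ((T ^^ k) x) = x" using returns[OF x] by blast
      have "(T ^^ m) ((T ^^ k) x) \<noteq> (T ^^ k) x" if "0 < m" "m < n" for m
      proof
        assume "(T ^^ m) ((T ^^ k) x) = (T ^^ k) x"
        then have "(T ^^ m) x = x" using j comm by metis
        then show False using x that by (auto simp: L_def)
      qed
      moreover have "(T ^^ n) ((T ^^ k) x) = (T ^^ k) x" using comm fix_pt[OF x] by simp
      ultimately show ?thesis using x TkX by (auto simp: L_def F_def)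
    qed
    have orb_eq: "orb y = orb x" if x: "x \<in> L n" and y: "y \<in> orb x" for x y
    proof -
      obtain k where k: "y = (T ^^ k) x" using y by (auto simp: orb_def)
      have yL: "y \<in> L n" using inL x k by simp
      obtain j where j: "(T ^^ j) y = x" using returns[OF x] k by blast
      have "z \<in> orb x" if "z \<in> orb y" for z
      proof -
        obtain i where "z = (T ^^ i) y" using \<open>z \<in> orb y\<close> by (auto simp: orb_def)
        then have "z = (T ^^ (i + k)) x" using k by (simp add: funpow_add)
        then show ?thesis using orb_all[OF x] by simp
      qed
      moreover have "z \<in> orb y" if "z \<in> orb x" for z
      proof -
        obtain i where "z = (T ^^ i) x" using \<open>z \<in> orb x\<close> by (auto simp: orb_def)
        then have "z = (T ^^ (i + j)) y" using j by (simp add: funpow_add)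
        then show ?thesis using orb_all[OF yL] by simp
      qed
      ultimately show ?thesis by blast
    qed
    have self: "x \<in> orb x" for x
      unfolding orb_def using n by (auto intro!: image_eqI[of _ _ 0])
    have orb_sub: "orb x \<subseteq> L n" if "x \<in> L n" for x using inL[OF that] by (auto simp: orb_def)
    have Un: "\<Union> (orb ` L n) = L n" using orb_sub self by blast
    have "n * card (orb ` L n) = card (\<Union> (orb ` L n))"
    proof (rule card_partition)
      show "finite (orb ` L n)" using finL[OF n] by simp
      show "finite (\<Union> (orb ` L n))" using finL[OF n] Un by simp
    next
      fix c assume "c \<in> orb ` L n"
      then obtain x where x: "x \<in> L n" "c = orb x" by auto
      have "inj_on (\<lambda>k. (T ^^ k) x) {..<n}"
      proof (rule linorder_inj_onI')
        fix i j assume ij: "i \<in> {..<n}" "j \<in> {..<n}" "i < j"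
        show "(T ^^ i) x \<noteq> (T ^^ j) x"
        proof
          assume "(T ^^ i) x = (T ^^ j) x"
          moreover have "(T ^^ (j - i)) ((T ^^ i) x) = (T ^^ j) x"
            using ij by (simp flip: funpow_add[THEN fun_cong, unfolded o_apply])
          ultimately have "(T ^^ (j - i)) ((T ^^ i) x) = (T ^^ i) x" by simp
          then have "n dvd j - i" using period[OF inL[OF x(1)] n] by blast
          then show False using ij by (auto dest: dvd_imp_le)
        qed
      qed
      then show "card c = n" by (simp add: x(2) orb_def card_image)
    next
      fix c d assume "c \<in> orb ` L n" "d \<in> orb ` L n" "c \<noteq> d"
      then show "c \<inter> d = {}" using orb_eq by blast
    qed
    then show ?thesis using Un by (metis dvd_triv_left)
  qed
  have "dirichlet_conv moebius_mu (\<lambda>d. int (a d)) n = int (card (L n))" if "n > 0" for n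
    by (rule moebius_inversion) (use sum that in auto)
  then show ?thesis using dvd by (auto simp: moebius_condition_def Suc_le_eq)
qed

lemma moebius_condition_imp_realizable:
  assumes "moebius_condition a"
  shows "realizable a"
proof -
  let ?c = "dirichlet_conv moebius_mu (\<lambda>d. int (a d))"
  define b where "b = (\<lambda>n. nat (?c n div int n))"
  have b: "int (n * b n) = ?c n" if "n > 0" for n
    using assms that by (auto simp: moebius_condition_def b_def Suc_le_eq pos_imp_zdiv_nonneg_iff)
  define Y where "Y = {(n, i, j). 0 < n \<and> i < b n \<and> j < (n :: nat)}"
  define S where "S = (\<lambda>(n, i :: nat, j). (n, i, (j + 1) mod (n :: nat)))"
  define enc where "enc = (\<lambda>(n, i, j). prod_encode (n, prod_encode (i, j)))"
  have inj: "inj enc" by (auto simp: enc_def inj_def)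
  define X where "X = enc ` Y"
  define T where "T = (\<lambda>x. enc (S (inv enc x)))"
  have Tk: "(T ^^ k) (enc y) = enc ((S ^^ k) y)" for k y
    by (induction k) (auto simp: T_def inv_f_f[OF inj])
  have Sk: "(S ^^ k) (n, i, j) = (n, i, (j + k) mod n)" if "j < n" for k n i j
    using that by (induction k) (auto simp: S_def mod_Suc_eq)
  have SY: "S y \<in> Y" if "y \<in> Y" for y using that by (auto simp: S_def Y_def)
  have TX: "T \<in> X \<rightarrow> X" using SY by (auto simp: X_def T_def inv_f_f[OF inj])
  have main: "finite {x \<in> X. (T ^^ m) x = x} \<and> card {x \<in> X. (T ^^ m) x = x} = a m" if m: "m > 0" for m
  proof -
    let ?P = "Sigma {n. n dvd m} (\<lambda>n. {..<b n} \<times> {..<n})"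
    have fx: "(j + m) mod n = j \<longleftrightarrow> n dvd m" if "j < n" for j n :: nat
    proof -
      have "(j + m) mod n = j \<longleftrightarrow> (j + m) mod n = (j + 0) mod n" using that by simp
      also have "\<dots> \<longleftrightarrow> m mod n = 0 mod n" using cong_add_lcancel_nat[of j m 0 n] by (simp add: cong_def)
      finally show ?thesis by auto
    qed
    have "{x \<in> X. (T ^^ m) x = x} = enc ` {y \<in> Y. (S ^^ m) y = y}"
      by (auto simp: X_def Tk inj_eq[OF inj])
    also have "{y \<in> Y. (S ^^ m) y = y} = ?P"
      using m by (auto simp: Y_def Sk fx)
    finally have eq: "{x \<in> X. (T ^^ m) x = x} = enc ` ?P" .
    have finD: "finite {n. n dvd m}" using m by simp
    have "int (card ?P) = (\<Sum>n | n dvd m. int (n * b n))"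
      using finD by (simp add: card_SigmaI mult.commute)
    also have "\<dots> = (\<Sum>n | n dvd m. ?c n)"
      by (rule sum.cong) (use m b in \<open>auto simp: dvd_pos_nat simp del: of_nat_mult\<close>)
    also have "\<dots> = int (a m)" by (rule sum_dirichlet_conv_moebius_mu[OF m])
    finally have "card ?P = a m" by simp
    moreover have "finite ?P" using finD by auto
    ultimately show ?thesis
      unfolding eq using inj by (simp add: card_image inj_on_subset)
  qed
  show ?thesis unfolding realizable_def realized_by_def
    using TX main by (auto simp: Suc_le_eq)
qed

theorem realizable_iff_moebius_condition: "realizable a \<longleftrightarrow> moebius_condition a"
  using moebius_condition_imp_realizable realized_by_imp_moebius_condition
  by (auto simp: realizable_def)

corollary realized_by_imp_realizable:
  fixes X :: "'a set"
  assumes "realized_by a X T"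
  shows "realizable a"
  using assms realized_by_imp_moebius_condition moebius_condition_imp_realizable by blast

text \<open>
  Truncated subtraction in the exponent is harmless: when \<open>2 * k > n\<close> the factor
  \<open>n choose (2 * k)\<close> vanishes.
\<close>

definition catalan_larcombe_french :: "nat \<Rightarrow> nat" where
  "catalan_larcombe_french n =
     2 ^ n * (\<Sum>k = 0..n. (n choose (2 * k)) * ((2 * k) choose k)\<^sup>2 * 4 ^ (n - 2 * k))"

end

theory Submission
  imports Defs
begin

text \<open>
  Since \<open>(2k choose k)\<^sup>2\<close> is the constant term of
  \<open>((x + 1/x) (y + 1/y)) ^ (2 * k)\<close>, the number \<open>P(n)\<close> is the constant term of
  \<open>(2 * (4 + (x + 1/x) (y + 1/y))) ^ n\<close>.  It therefore counts the closed walks of length \<open>n\<close>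
  in the plane with 16 coloured steps.  As the plane has no torsion, closed walks of
  length \<open>n\<close> are exactly the \<open>n\<close>-periodic points of the shift on the step sequences that are
  periodic with vanishing sum over some period.
\<close>

text \<open>Reading \<open>w k a\<close> as coordinate \<open>k\<close> of the step with letter
  \<open>a\<close>, these are the closed walks of length \<open>n\<close>. Extensionality off
  \<open>{..<n}\<close> makes each word a single function.\<close>

definition zero_sum_words :: "('k \<Rightarrow> 'a \<Rightarrow> int) \<Rightarrow> nat \<Rightarrow> (nat \<Rightarrow> 'a) set" where
  "zero_sum_words w n = {f \<in> {..<n} \<rightarrow>\<^sub>E UNIV. \<forall>k. (\<Sum>i<n. w k (f i)) = 0}"

lemma sum_periodic:
  fixes g :: "nat \<Rightarrow> int"
  assumes "\<And>i. g (i + m) = g i"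
  shows "(\<Sum>i<q * m. g i) = int q * (\<Sum>i<m. g i)"
proof (induction q)
  case (Suc q)
  have shift: "g (i + q * m) = g i" for i
  proof (induction q)
    case (Suc q)
    then show ?case using assms[of "i + q * m"] by (simp add: ac_simps)
  qed simp
  have "(\<Sum>i<Suc q * m. g i) = (\<Sum>i<q * m. g i) + (\<Sum>i<m. g (i + q * m))"
    using sum.nat_group[of g m "Suc q"] sum.nat_group[of g m q]
    by (simp add: lessThan_atLeast0 sum.shift_bounds_nat_ivl[of g 0 "q * m" m, symmetric]
        sum.atLeastLessThan_concat add.commute)
  also have "\<dots> = int (Suc q) * (\<Sum>i<m. g i)"
    by (simp only: shift Suc.IH) (simp add: algebra_simps)
  finally show ?case .
qed simp

lemma realizable_card_zero_sum_words:
  fixes w :: "'k \<Rightarrow> 'a::finite \<Rightarrow> int"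
  shows "realizable (\<lambda>n. card (zero_sum_words w n))"
proof -
  define T :: "(nat \<Rightarrow> 'a) \<Rightarrow> nat \<Rightarrow> 'a" where "T = (\<lambda>x i. x (Suc i))"
  \<comment> \<open>Asking for just one zero-sum period makes \<open>X\<close> independent of
    \<open>n\<close>; \<open>fixed_iff\<close> shows that then every period has sum zero.\<close>
  define X :: "(nat \<Rightarrow> 'a) set" where "X = {x. \<exists>m>0. (\<forall>i. x (i + m) = x i) \<and> (\<forall>k. (\<Sum>i<m. w k (x i)) = 0)}"
  have Tn: "(T ^^ n) x = (\<lambda>i. x (i + n))" for n x
    by (induction n) (auto simp: T_def)
  have fixed_iff: "x \<in> X \<and> (T ^^ n) x = x \<longleftrightarrow>
      (\<forall>i. x (i + n) = x i) \<and> (\<forall>k. (\<Sum>i<n. w k (x i)) = 0)" if n: "n > 0" for n x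
  proof
    assume A: "x \<in> X \<and> (T ^^ n) x = x"
    then have per: "x (i + n) = x i" for i by (metis Tn)
    obtain m where m: "m > 0" "\<And>i. x (i + m) = x i" "\<And>k. (\<Sum>i<m. w k (x i)) = 0"
      using A by (auto simp: X_def)
    have "(\<Sum>i<n. w k (x i)) = 0" for k
    proof -
      \<comment> \<open>The first \<open>m * n\<close> letters are \<open>m\<close> blocks of length
        \<open>n\<close> as well as \<open>n\<close> blocks of length \<open>m\<close>. The latter
        sum to zero, and \<open>m > 0\<close> cancels in the integers.\<close>
      have "int m * (\<Sum>i<n. w k (x i)) = (\<Sum>i<m * n. w k (x i))"
        by (rule sum_periodic[symmetric]) (simp add: per)
      also have "\<dots> = int n * (\<Sum>i<m. w k (x i))"
        by (subst mult.commute, rule sum_periodic) (simp add: m)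
      finally show ?thesis using m by simp
    qed
    with per show "(\<forall>i. x (i + n) = x i) \<and> (\<forall>k. (\<Sum>i<n. w k (x i)) = 0)" by blast
  next
    assume "(\<forall>i. x (i + n) = x i) \<and> (\<forall>k. (\<Sum>i<n. w k (x i)) = 0)"
    with n show "x \<in> X \<and> (T ^^ n) x = x" by (auto simp: X_def Tn)
  qed
  have TX: "T \<in> X \<rightarrow> X"
  proof
    fix x assume "x \<in> X"
    then obtain m where m: "m > 0" "\<And>i. x (i + m) = x i" "\<And>k. (\<Sum>i<m. w k (x i)) = 0"
      by (auto simp: X_def)
    have "(\<Sum>i<m. w k (x (Suc i))) = 0" for k
    proof -
      \<comment> \<open>Moving the window by one trades \<open>x 0\<close> for \<open>x m\<close>,
        which is the same letter.\<close>
      have "(\<Sum>i<m. w k (x (Suc i))) + w k (x 0) = (\<Sum>i<Suc m. w k (x i))"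
        by (subst sum.lessThan_Suc_shift) simp
      also have "\<dots> = w k (x 0)" using m(2)[of 0] m(3) by simp
      finally show ?thesis by simp
    qed
    then show "T x \<in> X" using m(1) m(2)[of "Suc _"] by (auto simp: X_def T_def)
  qed
  have bij: "bij_betw (\<lambda>x. restrict x {..<n}) {x \<in> X. (T ^^ n) x = x} (zero_sum_words w n)"
    if n: "n > 0" for n
  \<comment> \<open>A periodic point is determined by its first \<open>n\<close> letters; the
    inverse repeats a word periodically.\<close>
  proof (rule bij_betw_byWitness[where f' = "\<lambda>f i. f (i mod n)"])
    show "\<forall>x\<in>{x \<in> X. (T ^^ n) x = x}. (\<lambda>i. restrict x {..<n} (i mod n)) = x"
    proof
      fix x assume x: "x \<in> {x \<in> X. (T ^^ n) x = x}"
      have per: "x (i + n) = x i" for i using x fixed_iff[OF n] by auto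
      have "x (r + q * n) = x r" for r q
      proof (induction q)
        case (Suc q)
        then show ?case using per[of "r + q * n"] by (simp add: ac_simps)
      qed simp
      then have "x (i mod n) = x i" for i by (metis mod_div_mult_eq)
      then show "(\<lambda>i. restrict x {..<n} (i mod n)) = x" using n by auto
    qed
    show "\<forall>f\<in>zero_sum_words w n. restrict (\<lambda>i. f (i mod n)) {..<n} = f"
      by (auto simp: zero_sum_words_def fun_eq_iff restrict_def PiE_def extensional_def)
    show "(\<lambda>x. restrict x {..<n}) ` {x \<in> X. (T ^^ n) x = x} \<subseteq> zero_sum_words w n"
      using fixed_iff[OF n] by (auto simp: zero_sum_words_def split: if_splits)
    show "(\<lambda>f i. f (i mod n)) ` zero_sum_words w n \<subseteq> {x \<in> X. (T ^^ n) x = x}"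
      using fixed_iff[OF n] by (auto simp: zero_sum_words_def)
  qed
  have fin: "finite (zero_sum_words w n)" for n
    by (rule finite_subset[of _ "{..<n} \<rightarrow>\<^sub>E UNIV"])
      (auto simp: zero_sum_words_def intro: finite_PiE)
  have "realized_by (\<lambda>n. card (zero_sum_words w n)) X T"
    unfolding realized_by_def
    using TX bij_betw_finite[OF bij] bij_betw_same_card[OF bij] fin by (simp add: Suc_le_eq)
  \<comment> \<open>The points of \<open>X\<close> are functions, so the carrier has to be exchanged
    for a set of naturals.\<close>
  then show ?thesis by (rule realized_by_imp_realizable)
qed

text \<open>Such a set \<open>S\<close> amounts to a free choice of half of \<open>D\<close>
  together with any subset of \<open>N - D\<close>. With \<open>D\<close> the moving positions and
  \<open>S\<close> the positive signs, this counts the sign patterns of one coordinate.\<close>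

lemma card_halving_subsets:
  assumes "finite N" "D \<subseteq> N"
  shows "card {S. S \<subseteq> N \<and> 2 * card (S \<inter> D) = card D} =
    (if even (card D) then (card D choose (card D div 2)) * 2 ^ (card N - card D) else 0)"
proof (cases "even (card D)")
  case True
  have fin: "finite D" using assms finite_subset by blast
  have "bij_betw (\<lambda>S. (S \<inter> D, S - D)) {S. S \<subseteq> N \<and> 2 * card (S \<inter> D) = card D}
      ({A. A \<subseteq> D \<and> card A = card D div 2} \<times> Pow (N - D))"
  proof (rule bij_betw_byWitness[where f' = "\<lambda>(A, B). A \<union> B"])
    show "(\<lambda>(A, B). A \<union> B) ` ({A. A \<subseteq> D \<and> card A = card D div 2} \<times> Pow (N - D))
      \<subseteq> {S. S \<subseteq> N \<and> 2 * card (S \<inter> D) = card D}"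
    proof clarsimp
      fix A B assume *: "A \<subseteq> D" "card A = card D div 2" "B \<subseteq> N - D"
      then have "(A \<union> B) \<inter> D = A" by auto
      then show "A \<subseteq> N \<and> B \<subseteq> N \<and> 2 * card ((A \<union> B) \<inter> D) = card D"
        using * True assms by auto
    qed
  qed (use assms in auto)
  then show ?thesis
    using True assms fin
    by (simp add: bij_betw_same_card card_cartesian_product n_subsets card_Pow card_Diff_subset)
next
  case False
  then have "{S. S \<subseteq> N \<and> 2 * card (S \<inter> D) = card D} = {}" by (auto; metis even_mult_iff even_numeral)
  with False show ?thesis by (simp only: card.empty if_False)
qed

lemma sum_Pow_card:
  fixes g :: "nat \<Rightarrow> nat"
  assumes "finite N"
  shows "(\<Sum>D\<in>Pow N. g (card D)) = (\<Sum>j\<le>card N. (card N choose j) * g j)"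
proof -
  have "(\<Sum>D\<in>Pow N. g (card D)) = (\<Sum>j\<le>card N. \<Sum>D\<in>{D \<in> Pow N. card D = j}. g (card D))"
    by (rule sum.group[symmetric]) (use assms in \<open>auto intro: card_mono\<close>)
  also have "\<dots> = (\<Sum>j\<le>card N. card {D. D \<subseteq> N \<and> card D = j} * g j)"
    by (rule sum.cong) auto
  finally show ?thesis using assms by (simp add: n_subsets)
qed

text \<open>
  The letters of the alphabet are quadruples \<open>(c, d, s, t)\<close>: \<open>c\<close> is the colour, \<open>d\<close> tells
  whether the step moves, and \<open>s\<close>, \<open>t\<close> are the signs of its two coordinates.  The signs of
  a step that does not move account for the summand 4.
\<close>

definition diagonal_step :: "bool \<Rightarrow> bool \<times> bool \<times> bool \<times> bool \<Rightarrow> int" where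
  "diagonal_step k = (\<lambda>(c, d, s, t). if d then if (if k then s else t) then 1 else -1 else 0)"

text \<open>A position in \<open>D\<close> contributes twice the indicator of \<open>S\<close> minus
  1. Hence a coordinate returns to 0 exactly when \<open>S\<close> contains half of
  \<open>D\<close>.\<close>

lemma sum_signs:
  assumes "finite N" "D \<subseteq> N"
  shows "(\<Sum>i\<in>N. if i \<in> D then if i \<in> S then 1 else -1 else 0) =
    2 * int (card (S \<inter> D)) - int (card D)"
proof -
  have fin: "finite D" using assms finite_subset by blast
  have "(\<Sum>i\<in>N. if i \<in> D then if i \<in> S then 1 else -1 else 0) =
      (\<Sum>i\<in>D. if i \<in> S then 1 else -1 :: int)"
    using assms by (simp add: sum.If_cases Int_absorb1)
  also have "\<dots> = (\<Sum>i\<in>D. 2 * (if i \<in> S then 1 else 0) - 1)"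
    by (rule sum.cong) auto
  also have "\<dots> = 2 * int (card (S \<inter> D)) - int (card D)"
    using fin by (simp add: sum_subtractf sum.If_cases Int_commute flip: sum_distrib_left)
  finally show ?thesis .
qed

text \<open>A word is split into four position sets: \<open>C\<close> for the colour,
  \<open>D\<close> for the moves, \<open>S\<close> and \<open>T\<close> for the signs. The set
  \<open>C\<close> is free and gives \<open>2 ^ n\<close>. Once \<open>D\<close> is fixed,
  \<open>S\<close> and \<open>T\<close> are chosen independently from \<open>H D\<close>, whence the
  square; only \<open>D\<close> of even size \<open>2 * k\<close> contribute.\<close>

lemma card_zero_sum_words_diagonal_step:
  "card (zero_sum_words diagonal_step n) = catalan_larcombe_french n"
proof -
  let ?N = "{..<n}"
  define H where "H = (\<lambda>D. {S. S \<subseteq> ?N \<and> 2 * card (S \<inter> D) = card D})"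
  let ?Y = "Pow ?N \<times> (SIGMA D:Pow ?N. H D \<times> H D)"
  let ?sets = "\<lambda>f :: nat \<Rightarrow> bool \<times> bool \<times> bool \<times> bool. ({i\<in>?N. fst (f i)}, {i\<in>?N. fst (snd (f i))},
      {i\<in>?N. fst (snd (snd (f i)))}, {i\<in>?N. snd (snd (snd (f i)))})"
  let ?word = "\<lambda>(C, D, S, T). \<lambda>i\<in>?N. (i \<in> C, i \<in> D, i \<in> S, i \<in> T)"
  have zero_iff: "(\<Sum>i<n. if i \<in> D then if i \<in> S then 1 else -1 else 0 :: int) = 0 \<longleftrightarrow> S \<in> H D"
    if "S \<subseteq> ?N" "D \<subseteq> ?N" for S D
    using that sum_signs[of ?N D S] by (auto simp: H_def)
  have "bij_betw ?sets (zero_sum_words diagonal_step n) ?Y"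
  proof (rule bij_betw_byWitness[where f' = ?word])
    show "\<forall>f\<in>zero_sum_words diagonal_step n. ?word (?sets f) = f"
      by (auto simp: zero_sum_words_def fun_eq_iff restrict_def PiE_def extensional_def)
    show "\<forall>y\<in>?Y. ?sets (?word y) = y"
      by (auto simp: H_def)
    show "?sets ` zero_sum_words diagonal_step n \<subseteq> ?Y"
    proof (rule image_subsetI)
      fix f assume f: "f \<in> zero_sum_words diagonal_step n"
      let ?D = "{i\<in>?N. fst (snd (f i))}"
      have "(\<Sum>i<n. if i \<in> ?D then if i \<in> {i\<in>?N. fst (snd (snd (f i)))} then 1 else -1 else 0 :: int)
          = (\<Sum>i<n. diagonal_step True (f i))"
        by (rule sum.cong) (auto simp: diagonal_step_def split: prod.splits)
      moreover have "(\<Sum>i<n. if i \<in> ?D then if i \<in> {i\<in>?N. snd (snd (snd (f i)))} then 1 else -1 else 0 :: int)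
          = (\<Sum>i<n. diagonal_step False (f i))"
        by (rule sum.cong) (auto simp: diagonal_step_def split: prod.splits)
      ultimately have "{i\<in>?N. fst (snd (snd (f i)))} \<in> H ?D" "{i\<in>?N. snd (snd (snd (f i)))} \<in> H ?D"
        using f by (subst zero_iff[symmetric]; force simp: zero_sum_words_def)+
      then show "?sets f \<in> ?Y" by blast
    qed
    show "?word ` ?Y \<subseteq> zero_sum_words diagonal_step n"
    proof (rule image_subsetI)
      fix y assume "y \<in> ?Y"
      then obtain C D S T where y: "y = (C, D, S, T)" and *: "D \<subseteq> ?N" "S \<in> H D" "T \<in> H D"
        by auto
      have sub: "S \<subseteq> ?N" "T \<subseteq> ?N" using * by (auto simp: H_def)
      have "(\<Sum>i<n. diagonal_step k (restrict (\<lambda>i. (i \<in> C, i \<in> D, i \<in> S, i \<in> T)) ?N i)) = 0" for k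
        using zero_iff[OF sub(1) *(1)] zero_iff[OF sub(2) *(1)] *(2,3)
        by (cases k) (simp_all add: diagonal_step_def cong: if_cong)
      then show "?word y \<in> zero_sum_words diagonal_step n"
        by (simp add: y zero_sum_words_def)
    qed
  qed
  then have "card (zero_sum_words diagonal_step n) = card ?Y" by (rule bij_betw_same_card)
  also have "\<dots> = 2 ^ n * (\<Sum>D\<in>Pow ?N. (card (H D))\<^sup>2)"
  proof -
    have "finite (H D)" for D by (rule finite_subset[of _ "Pow ?N"]) (auto simp: H_def)
    then show ?thesis
      by (simp add: card_cartesian_product card_Pow card_SigmaI power2_eq_square)
  qed
  also have "(\<Sum>D\<in>Pow ?N. (card (H D))\<^sup>2) = (\<Sum>D\<in>Pow ?N.
      (\<lambda>j. if even j then (j choose (j div 2))\<^sup>2 * 4 ^ (n - j) else 0) (card D))"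
  proof (rule sum.cong)
    fix D assume "D \<in> Pow ?N"
    then have "card (H D) = (if even (card D)
        then (card D choose (card D div 2)) * 2 ^ (n - card D) else 0)"
      using card_halving_subsets[of ?N D] by (simp add: H_def)
    moreover have "(2 ^ m)\<^sup>2 = (4 :: nat) ^ m" for m
      by (simp add: power2_eq_square flip: power_mult_distrib)
    ultimately show "(card (H D))\<^sup>2 = (\<lambda>j. if even j
        then (j choose (j div 2))\<^sup>2 * 4 ^ (n - j) else 0) (card D)"
      by (simp add: power_mult_distrib)
  qed simp
  also have "\<dots> = (\<Sum>j\<le>n. (n choose j) *
      (if even j then (j choose (j div 2))\<^sup>2 * 4 ^ (n - j) else 0))"
    by (subst sum_Pow_card) simp_all
  \<comment> \<open>The two index sets differ only in zero terms: odd \<open>j\<close> vanish by the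
    \<open>if\<close>, even \<open>j > n\<close> by \<open>n choose j\<close>.\<close>
  also have "\<dots> = (\<Sum>j\<in>(*) 2 ` {0..n}. (n choose j) *
      (if even j then (j choose (j div 2))\<^sup>2 * 4 ^ (n - j) else 0))"
    by (rule sum.mono_neutral_cong) (auto elim!: evenE)
  also have "\<dots> = (\<Sum>k = 0..n. (n choose (2 * k)) * ((2 * k) choose k)\<^sup>2 * 4 ^ (n - 2 * k))"
    by (subst sum.reindex) (auto simp: inj_on_def mult.assoc)
  finally show ?thesis by (simp add: catalan_larcombe_french_def)
qed

theorem mainTheorem5:
  shows "realizable catalan_larcombe_french"
  using realizable_card_zero_sum_words[of diagonal_step]
  by (simp add: card_zero_sum_words_diagonal_step)

end
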